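(* Let $p$ be a prime, $q=p^2$, and $f=x^{q-p}\in\mathbb{F}_q[x]$. Then $\deg(S_f)=p$.
   Context: $\mathrm{PG}(2,q)$ is the projective plane over $\mathbb{F}_q$. For $f\in\mathbb{F}_q[x]$, $S_f=\{(x,f(x),1):x\in\mathbb{F}_q\}\cup\{(0,1,0)\}$. For a set $D$ of $q+1$ points, $u_i(D)$ is the number of lines of $\mathrm{PG}(2,q)$ containing exactly $i$ points of $D$, and $\deg(D)$ is the largest $i$ with $u_i(D)\neq 0$. *)

theory Defs
  imports "HOL-Analysis.Analysis" "HOL-Computational_Algebra.Computational_Algebra"
begin

text \<open>
  The field \<open>\<F>\<^sub>q\<close> is a type \<open>'a\<close> of sort \<open>{field, finite}\<close> with \<open>CARD('a) = q\<close>. Points and lines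
  of \<open>PG(2,q)\<close> are the subspaces of \<open>'a ^ 3\<close> of dimension 1 and 2, and a point lies on a line
  iff it is contained in it.
\<close>

definition pg_points :: "('a::{field,finite} ^ 3) set set" where
  "pg_points = {P. vec.subspace P \<and> vec.dim P = 1}"

definition pg_lines :: "('a::{field,finite} ^ 3) set set" where
  "pg_lines = {L. vec.subspace L \<and> vec.dim L = 2}"

definition pg_point :: "'a::{field,finite} \<Rightarrow> 'a \<Rightarrow> 'a \<Rightarrow> ('a ^ 3) set" where
  "pg_point x y z = vec.span {vector [x, y, z]}"

definition S_set :: "'a::{field,finite} poly \<Rightarrow> ('a ^ 3) set set" where
  "S_set f = {pg_point x (poly f x) 1 | x. True} \<union> {pg_point 0 1 0}"

definition u_lines :: "nat \<Rightarrow> ('a::{field,finite} ^ 3) set set \<Rightarrow> nat" where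
  "u_lines i D = card {L \<in> pg_lines. card {P \<in> D. P \<subseteq> L} = i}"

definition pg_deg :: "('a::{field,finite} ^ 3) set set \<Rightarrow> nat" where
  "pg_deg D = Max {i. u_lines i D \<noteq> 0}"

lemma vector_3_eq_iff:
  "(vector [a, b, c] :: 'a::zero ^ 3) = vector [x, y, z] \<longleftrightarrow> a = x \<and> b = y \<and> c = z"
  by (auto simp: vec_eq_iff forall_3)

lemma pg_point_eq_range: "pg_point x y z = range (\<lambda>k. vector [k * x, k * y, k * z])"
  unfolding pg_point_def vec.span_singleton
  by (intro image_cong refl) (simp add: vec_eq_iff forall_3)

lemma pg_point_in_pg_points:
  assumes "(x, y, z) \<noteq> (0, 0, 0)"
  shows "pg_point x y z \<in> pg_points"
proof -
  have "(vector [x, y, z] :: 'a ^ 3) \<noteq> 0"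
    using assms by (auto simp: vec_eq_iff forall_3)
  then show ?thesis
    by (simp add: pg_point_def pg_points_def vec.dim_eq_card_independent)
qed

lemma S_set_subset_pg_points: "S_set f \<subseteq> pg_points"
  by (auto simp: S_set_def intro!: pg_point_in_pg_points)

lemma card_S_set: "card (S_set (f :: 'a::{field,finite} poly)) = CARD('a) + 1"
proof -
  have inj: "inj (\<lambda>x. pg_point x (poly f x) 1)"
  proof (rule injI)
    fix x y assume "pg_point x (poly f x) 1 = pg_point y (poly f y) 1"
    moreover have "vector [x, poly f x, 1] \<in> pg_point x (poly f x) 1"
      unfolding pg_point_eq_range by (rule range_eqI[of _ _ 1]) simp
    ultimately have "vector [x, poly f x, 1] \<in> pg_point y (poly f y) 1"
      by simp
    then show "x = y"
      by (auto simp: pg_point_eq_range vector_3_eq_iff)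
  qed
  have "pg_point 0 1 0 \<noteq> pg_point x (poly f x) 1" for x
  proof
    assume "pg_point 0 1 0 = pg_point x (poly f x) 1"
    moreover have "vector [x, poly f x, 1] \<in> pg_point x (poly f x) 1"
      unfolding pg_point_eq_range by (rule range_eqI[of _ _ 1]) simp
    ultimately have "vector [x, poly f x, 1] \<in> pg_point 0 1 0"
      by simp
    then show False
      by (auto simp: pg_point_eq_range vector_3_eq_iff)
  qed
  then have "pg_point 0 1 0 \<notin> range (\<lambda>x. pg_point x (poly f x) 1)"
    by blast
  moreover have "S_set f = insert (pg_point 0 1 0) (range (\<lambda>x. pg_point x (poly f x) 1))"
    by (auto simp: S_set_def)
  ultimately show ?thesis
    using inj by (simp add: card_image)
qed

end

theory Submission
  imports Defs "HOL-Number_Theory.Cong"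
begin

text \<open>
  For \<open>x \<noteq> 0\<close> we have \<open>f x = x ^ (q - p) = 1 / x ^ (p - 1)\<close>, so a line \<open>a X + b Y + c Z = 0\<close>
  with \<open>b \<noteq> 0\<close> meets \<open>S_f\<close>, off \<open>x = 0\<close>, in the roots of \<open>a x ^ p + c x ^ (p - 1) + b\<close>. This
  gives at most \<open>p\<close> points when \<open>c \<noteq> 0\<close>; when \<open>c = 0\<close>, the point with \<open>x = 0\<close> comes in, but
  \<open>x ^ p\<close> determines \<open>x\<close>, so there are at most two points.

  Substituting \<open>y = 1 / x\<close>, the line \<open>Y = m X + Z\<close> corresponds to the equation \<open>y ^ p - y = m\<close>.
  If \<open>m = t ^ p - t\<close> for some \<open>t\<close> outside the prime field, its solutions are the \<open>p\<close> nonzero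
  elements \<open>t + i\<close> with \<open>i\<close> in the prime field, so the bound is attained.
\<close>

no_notation fps_nth (infixl \<open>$\<close> 75)

section \<open>Powers and characteristic in a finite field\<close>

text \<open>Multiplication by \<open>x\<close> permutes the nonzero elements, so their product is
  unchanged by the factor \<open>x ^ (CARD('a) - 1)\<close>, and this nonzero product
  cancels.\<close>

lemma power_CARD_minus_one_eq_one:
  fixes x :: "'a::{field,finite}"
  assumes "x \<noteq> 0"
  shows "x ^ (CARD('a) - 1) = 1"
proof -
  have "(\<Prod>y\<in>UNIV-{0}. x * y) = (\<Prod>y\<in>UNIV-{0::'a}. y)"
    by (rule prod.reindex_bij_witness[of _ "\<lambda>y. y / x" "\<lambda>y. x * y"]) (use assms in auto)
  then have "x ^ (CARD('a) - 1) * \<Prod>(UNIV-{0::'a}) = 1 * \<Prod>(UNIV-{0})"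
    by (simp add: prod.distrib)
  moreover have "\<Prod>(UNIV-{0::'a}) \<noteq> 0"
    by simp
  ultimately show ?thesis
    using mult_right_cancel by blast
qed

lemma power_graph_mult_eq_one:
  fixes x :: "'a::{field,finite}"
  assumes p: "prime p" and q: "CARD('a) = p ^ 2" and x: "x \<noteq> 0"
  shows "x ^ (p ^ 2 - p) * x ^ (p - 1) = 1"
proof -
  have "p < p ^ 2"
    using prime_ge_2_nat[OF p] by (simp add: power2_eq_square)
  then have "p ^ 2 - p + (p - 1) = CARD('a) - 1"
    using prime_ge_2_nat[OF p] by (simp add: q)
  then show ?thesis
    using power_CARD_minus_one_eq_one[OF x] by (simp flip: power_add)
qed

text \<open>Translation by 1 permutes the field, so comparing the sums of all elements gives
  \<open>of_nat CARD('a) = 0\<close>. The characteristic is thus a prime divisor of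
  \<open>p ^ n\<close>.\<close>

lemma CHAR_eq_of_CARD_eq_prime_power:
  assumes "prime p" "CARD('a::{field,finite}) = p ^ n"
  shows "CHAR('a) = p"
proof -
  have "(\<Sum>y\<in>UNIV. y + 1) = (\<Sum>y\<in>UNIV. y :: 'a)"
    by (rule sum.reindex_bij_witness[of _ "\<lambda>y. y - 1" "\<lambda>y. y + 1"]) auto
  then have "of_nat CARD('a) = (0 :: 'a)"
    by (simp add: sum.distrib)
  then have "CHAR('a) dvd p ^ n"
    by (simp only: of_nat_eq_0_iff_char_dvd assms(2))
  moreover have "prime CHAR('a)"
    by (rule prime_CHAR_semidom) (simp add: finite_imp_CHAR_pos)
  ultimately show ?thesis
    using assms(1) prime_dvd_power primes_dvd_imp_eq by blast
qed

section \<open>Coordinates for lines and points\<close>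

lemma pg_line_subset_equation:
  fixes L :: "('a::{field,finite} ^ 3) set"
  assumes "L \<in> pg_lines"
  obtains a b c where "(a, b, c) \<noteq> (0, 0, 0)" "\<And>v. v \<in> L \<Longrightarrow> a * v$1 + b * v$2 + c * v$3 = 0"
proof -
  have "vec.dim L = 2"
    using assms by (simp add: pg_lines_def)
  then obtain B where B: "L \<subseteq> vec.span B" "card B = 2"
    using vec.basis_exists by metis
  then obtain u w where uw: "B = {u, w}"
    by (auto simp: card_2_iff)
  \<comment> \<open>The zero third row makes \<open>A\<close> singular. The entries of a nonzero
    kernel vector \<open>n\<close> are the coefficients of a linear form vanishing on
    \<open>u\<close> and \<open>w\<close>, hence on their span.\<close>
  define A :: "'a^3^3" where "A = vector [u, w, 0]"
  have rows: "A $ 1 = u" "A $ 2 = w" "A $ 3 = 0"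
    by (simp_all add: A_def)
  have "det A = 0"
    by (simp add: det_3 rows)
  then have "\<not> (\<exists>B. B ** A = mat 1)"
    using invertible_det_nz invertible_left_inverse by blast
  then obtain n where n: "n \<noteq> 0" "A *v n = 0"
    unfolding matrix_left_invertible_ker by blast
  have "(A *v n) $ 1 = 0" "(A *v n) $ 2 = 0"
    using n by simp_all
  define g where "g v = n$1 * v$1 + n$2 * v$2 + n$3 * v$3" for v :: "'a^3"
  have g_linear: "g 0 = 0" "g (x + y) = g x + g y" "g (k *s x) = k * g x" for x y k
    by (simp_all add: g_def algebra_simps)
  have "g u = 0" "g w = 0"
    using \<open>(A *v n) $ 1 = 0\<close> \<open>(A *v n) $ 2 = 0\<close>
    by (simp_all add: g_def matrix_vector_mult_def sum_3 rows mult.commute)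
  moreover have "vec.subspace {v. g v = 0}"
    by (simp add: vec.subspace_def g_linear)
  ultimately have "vec.span B \<subseteq> {v. g v = 0}"
    by (intro vec.span_minimal) (auto simp: uw)
  then have "n$1 * v$1 + n$2 * v$2 + n$3 * v$3 = 0" if "v \<in> L" for v
    using B that by (auto simp: g_def)
  moreover have "(n$1, n$2, n$3) \<noteq> (0, 0, 0)"
    using n(1) by (auto simp: vec_eq_iff forall_3)
  ultimately show thesis
    using that by blast
qed

lemma vector_in_pg_point: "vector [x, y, z] \<in> pg_point x y z"
  unfolding pg_point_def by (simp add: vec.span_base)

text \<open>Vectors spanning the same point differ by a scalar, and the third coordinate 1 forces
  this scalar to be 1.\<close>

lemma inj_pg_point_graph: "inj (\<lambda>x. pg_point x (g x) (1::'a::{field,finite}))"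
proof (rule injI)
  fix x y assume "pg_point x (g x) 1 = pg_point y (g y) 1"
  then have "vector [x, g x, 1] \<in> pg_point y (g y) 1"
    using vector_in_pg_point by blast
  then show "x = y"
    by (auto simp: pg_point_eq_range vector_3_eq_iff)
qed

section \<open>Upper bound for the intersection with a line\<close>

lemma card_line_inter_graph_le:
  fixes a b c :: "'a::{field,finite}"
  assumes p: "prime p" and q: "CARD('a) = p ^ 2" and b: "b \<noteq> 0"
  shows "card {x. a * x + b * x ^ (p ^ 2 - p) + c = 0} \<le> p"
proof -
  have p2: "p \<ge> 2"
    using p by (rule prime_ge_2_nat)
  have lt: "p < p ^ 2"
    using p2 by (simp add: power2_eq_square)
  have eq: "a * x ^ p + c * x ^ (p - 1) + b = 0"
    if x: "a * x + b * x ^ (p ^ 2 - p) + c = 0" "x \<noteq> 0" for x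
  proof -
    have "x ^ (p ^ 2 - p) * x ^ (p - 1) = 1"
      using power_graph_mult_eq_one[OF p q] x by simp
    moreover have "x ^ p = x * x ^ (p - 1)"
      using p2 by (simp add: power_eq_if)
    moreover have "(a * x + b * x ^ (p ^ 2 - p) + c) * x ^ (p - 1)
        = a * (x * x ^ (p - 1)) + b * (x ^ (p ^ 2 - p) * x ^ (p - 1)) + c * x ^ (p - 1)"
      by (simp only: distrib_right mult.assoc)
    ultimately show ?thesis
      using x by (simp add: add.commute add.left_commute)
  qed
  show ?thesis
  proof (cases "c = 0")
    case True
    \<comment> \<open>Raising \<open>x ^ p = - b / a\<close> to the power \<open>p\<close> recovers
      \<open>x\<close>, because \<open>x ^ (p ^ 2) = x\<close> in a field with \<open>p ^ 2\<close>
      elements.\<close>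
    have "x = (- b / a) ^ p" if x: "a * x + b * x ^ (p ^ 2 - p) + c = 0" "x \<noteq> 0" for x
    proof -
      have *: "a * x ^ p + b = 0"
        using eq[OF x] True by simp
      with b have "a \<noteq> 0"
        by auto
      with * have "x ^ p = - b / a"
        by (simp add: field_simps eq_neg_iff_add_eq_0)
      then have "(- b / a) ^ p = x ^ (p ^ 2)"
        by (simp add: power2_eq_square power_mult)
      also have "\<dots> = x * x ^ (CARD('a) - 1)"
        using lt by (simp add: q power_eq_if)
      finally show ?thesis
        using power_CARD_minus_one_eq_one x by simp
    qed
    then have "{x. a * x + b * x ^ (p ^ 2 - p) + c = 0} \<subseteq> {0, (- b / a) ^ p}"
      by blast
    then have "card {x. a * x + b * x ^ (p ^ 2 - p) + c = 0} \<le> card {0, (- b / a) ^ p}"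
      by (intro card_mono) auto
    also have "\<dots> \<le> p"
      using p2 by (simp add: card_insert_if)
    finally show ?thesis .
  next
    case False
    \<comment> \<open>Since \<open>c \<noteq> 0\<close>, the value \<open>x = 0\<close> is no
      solution, so every solution is a root of \<open>h\<close>. The nonzero constant term
      \<open>b\<close> shows \<open>h \<noteq> 0\<close>.\<close>
    define h where "h = monom a p + monom c (p - 1) + [:b:]"
    have "poly h 0 = b"
      using p2 by (simp add: h_def poly_monom power_0_left)
    with b have "h \<noteq> 0"
      by auto
    have "{x. a * x + b * x ^ (p ^ 2 - p) + c = 0} \<subseteq> {x. poly h x = 0}"
    proof clarify
      fix x assume x: "a * x + b * x ^ (p ^ 2 - p) + c = 0"
      with False lt have "x \<noteq> 0"
        by (auto simp: power_0_left)
      then show "poly h x = 0"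
        using eq[OF x] by (simp add: h_def poly_monom)
    qed
    then have "card {x. a * x + b * x ^ (p ^ 2 - p) + c = 0} \<le> card {x. poly h x = 0}"
      by (intro card_mono) auto
    also have "\<dots> \<le> degree h"
      using \<open>h \<noteq> 0\<close> by (rule card_poly_roots_bound)
    also have "\<dots> \<le> p"
      unfolding h_def
      by (intro degree_add_le order.trans[OF degree_monom_le]) auto
    finally show ?thesis .
  qed
qed

text \<open>The point (0,1,0) can lie on the line only if \<open>b = 0\<close>. In that case the
  equation \<open>a * x + c = 0\<close> allows at most one further point, and two points are within
  the bound as \<open>p \<ge> 2\<close>.\<close>

lemma card_S_set_inter_line_le:
  fixes L :: "('a::{field,finite} ^ 3) set"
  assumes p: "prime p" and q: "CARD('a) = p ^ 2" and L: "L \<in> pg_lines"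
  shows "card {P \<in> S_set (monom 1 (p ^ 2 - p)). P \<subseteq> L} \<le> p"
proof -
  obtain a b c where nz: "(a, b, c) \<noteq> (0, 0, 0)"
    and abc: "\<And>v. v \<in> L \<Longrightarrow> a * v$1 + b * v$2 + c * v$3 = 0"
    using pg_line_subset_equation[OF L] by metis
  have on: "a * x + b * y + c * z = 0" if "pg_point x y z \<subseteq> L" for x y z
    using abc[of "vector [x, y, z]"] that vector_in_pg_point by force
  define X where "X = {x. a * x + b * x ^ (p ^ 2 - p) + c = 0}"
  let ?P = "\<lambda>x. pg_point x (x ^ (p ^ 2 - p)) 1"
  have sub: "{P \<in> S_set (monom 1 (p ^ 2 - p)). P \<subseteq> L}
      \<subseteq> ?P ` X \<union> (if b = 0 then {pg_point 0 1 0} else {})"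
    using on by (fastforce simp: S_set_def X_def poly_monom)
  have "card {P \<in> S_set (monom 1 (p ^ 2 - p)). P \<subseteq> L}
      \<le> card (?P ` X) + card (if b = 0 then {pg_point 0 1 (0::'a)} else {})"
    by (rule order.trans[OF card_mono[OF _ sub] card_Un_le]) simp
  also have "\<dots> \<le> card X + (if b = 0 then 1 else 0)"
    using card_image_le[of X ?P] by simp
  also have "\<dots> \<le> p"
  proof (cases "b = 0")
    case True
    \<comment> \<open>If \<open>a = 0\<close>, then \<open>c \<noteq> 0\<close> and \<open>X\<close>
      is empty, so the inclusion holds whatever value the division by zero has.\<close>
    have "X \<subseteq> {- c / a}"
      using True nz by (cases "a = 0") (auto simp: X_def field_simps eq_neg_iff_add_eq_0)
    then have "card X \<le> 1"
      using card_mono[of "{- c / a}" X] by simp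
    then show ?thesis
      using True prime_ge_2_nat[OF p] by simp
  next
    case False
    then show ?thesis
      using card_line_inter_graph_le[OF p q] by (simp add: X_def)
  qed
  finally show ?thesis .
qed

section \<open>A line attaining the bound\<close>

lemma pg_line_graph:
  fixes m :: "'a::{field,finite}"
  shows "{v. v$2 = m * v$1 + v$3} \<in> pg_lines"
proof -
  let ?L = "{v :: 'a^3. v$2 = m * v$1 + v$3}"
  \<comment> \<open>The first and third coordinates parametrize \<open>?L\<close>; the parameters
    (1,0) and (0,1) give this basis.\<close>
  let ?u = "vector [1, m, 0] :: 'a^3" and ?w = "vector [0, 1, 1] :: 'a^3"
  have sub: "vec.subspace ?L"
    by (auto simp: vec.subspace_def algebra_simps)
  have "vec.dim ?L = 2"
  proof (rule vec.dim_unique)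
    show "{?u, ?w} \<subseteq> ?L"
      by simp
    show "?L \<subseteq> vec.span {?u, ?w}"
    proof clarify
      fix v :: "'a^3" assume "v$2 = m * v$1 + v$3"
      then have "v = v$1 *s ?u + v$3 *s ?w"
        by (simp add: vec_eq_iff forall_3 mult.commute)
      moreover have "v$1 *s ?u + v$3 *s ?w \<in> vec.span {?u, ?w}"
        by (intro vec.span_add vec.span_scale vec.span_base) auto
      ultimately show "v \<in> vec.span {?u, ?w}"
        by simp
    qed
    have "?u \<noteq> k *s ?w" for k
      by (simp add: vec_eq_iff forall_3)
    moreover have "?w \<noteq> 0"
      by (simp add: vec_eq_iff forall_3)
    ultimately show "vec.independent {?u, ?w}"
      by (auto simp: vec.independent_insert vec.span_singleton)
    show "card {?u, ?w} = 2"
      by (simp add: card_insert_if vector_3_eq_iff)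
  qed
  with sub show ?thesis
    by (simp add: pg_lines_def)
qed

lemma ex_line_card_S_set_inter_ge:
  assumes p: "prime p" and q: "CARD('a::{field,finite}) = p ^ 2"
  obtains L :: "('a::{field,finite} ^ 3) set" where "L \<in> pg_lines"
    "p \<le> card {P \<in> S_set (monom 1 (p ^ 2 - p)). P \<subseteq> L}"
proof -
  have char: "CHAR('a) = p"
    using p q by (rule CHAR_eq_of_CARD_eq_prime_power)
  have p2: "p \<ge> 2"
    using p by (rule prime_ge_2_nat)
  have lt: "p < p ^ 2"
    using p2 by (simp add: power2_eq_square)
  have frob: "(x + y) ^ p = x ^ p + y ^ p" for x y :: 'a
    using p char by (intro freshmans_dream) auto
  have frob_nat: "of_nat i ^ p = (of_nat i :: 'a)" for i
    by (induction i) (use p2 in \<open>auto simp: frob power_0_left\<close>)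
  have inj: "inj_on (of_nat :: nat \<Rightarrow> 'a) {..<p}"
    by (auto simp: inj_on_def of_nat_eq_iff_cong_CHAR char cong_def)
  \<comment> \<open>The prime field has only \<open>p < p ^ 2\<close> elements, which leaves room
    for \<open>t\<close>.\<close>
  have "card (of_nat ` {..<p} :: 'a set) < CARD('a)"
    using lt by (simp add: card_image[OF inj] q)
  then obtain t :: 'a where t: "t \<notin> of_nat ` {..<p}"
    by (metis UNIV_eq_I less_irrefl)
  have of_nat_mod: "of_nat (i mod p) = (of_nat i :: 'a)" for i
    by (simp add: of_nat_eq_iff_cong_CHAR char)
  \<comment> \<open>The negative of \<open>of_nat i\<close> is \<open>of_nat (i * (p - 1))\<close>,
    so a zero sum would put \<open>t\<close> into the prime field.\<close>
  have nz: "t + of_nat i \<noteq> 0" for i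
  proof
    assume zero: "t + of_nat i = 0"
    have "i * p = i + i * (p - 1)"
      using p2 by (simp flip: mult_Suc_right)
    moreover have "of_nat (i * p) = (0::'a)"
      unfolding of_nat_eq_0_iff_char_dvd char by (rule dvd_triv_right)
    ultimately have "of_nat i + of_nat (i * (p - 1)) = (0::'a)"
      by (simp only: of_nat_add)
    with zero have "t = of_nat (i * (p - 1))"
      by (metis add.commute add_right_cancel)
    then have "t = of_nat ((i * (p - 1)) mod p)"
      by (simp only: of_nat_mod)
    then show False
      using t p2 by (auto simp del: of_nat_mult)
  qed
  \<comment> \<open>With this slope every \<open>y = t + of_nat i\<close> satisfies
    \<open>y ^ p = y + m\<close>, since the Frobenius map is additive and fixes
    \<open>of_nat i\<close>.\<close>
  define m where "m = t ^ p - t"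
  define L :: "('a^3) set" where "L = {v. v$2 = m * v$1 + v$3}"
  have L: "L \<in> pg_lines"
    unfolding L_def by (rule pg_line_graph)
  let ?P = "\<lambda>x::'a. pg_point x (x ^ (p ^ 2 - p)) 1"
  let ?x = "\<lambda>i. inverse (t + of_nat i)"
  have on: "?P (?x i) \<subseteq> L" for i
  proof -
    define y where "y = t + of_nat i"
    have y: "y \<noteq> 0" "y ^ p = y + m"
      using nz by (simp_all add: y_def m_def frob frob_nat)
    have "y ^ (p ^ 2 - p) * y ^ (p - 1) = 1"
      using power_graph_mult_eq_one[OF p q] y by simp
    \<comment> \<open>The value of the graph at \<open>inverse y\<close> is
      \<open>y ^ p / y = (y + m) / y\<close>, which is the line equation at third coordinate
      1.\<close>
    then have "inverse y ^ (p ^ 2 - p) = y ^ (p - 1)"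
      unfolding power_inverse by (rule inverse_unique)
    also have "\<dots> = y ^ p / y"
      using y(1) p2 by (simp add: power_eq_if[of y p])
    also have "\<dots> = m * inverse y + 1"
      using y by (simp add: field_simps)
    finally have "vector [inverse y, inverse y ^ (p ^ 2 - p), 1] \<in> L"
      by (simp add: L_def)
    then show ?thesis
      using L unfolding pg_point_def pg_lines_def y_def
      by (intro vec.span_minimal) auto
  qed
  have "inj_on (?P \<circ> ?x) {..<p}"
  proof (rule comp_inj_on)
    show "inj_on ?x {..<p}"
      using inj by (simp add: inj_on_def)
    show "inj_on ?P (?x ` {..<p})"
      by (rule inj_on_subset[OF inj_pg_point_graph]) simp
  qed
  then have "p = card ((?P \<circ> ?x) ` {..<p})"
    by (simp only: card_image card_lessThan)
  also have "\<dots> \<le> card {P \<in> S_set (monom 1 (p ^ 2 - p)). P \<subseteq> L}"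
    by (intro card_mono) (use on in \<open>auto simp: S_set_def poly_monom\<close>)
  finally show thesis
    using that L by blast
qed

theorem theorem3p20:
  fixes p q :: nat and f :: "'a::{field,finite} poly"
  assumes "prime p"
    and "q = p ^ 2"
    and "CARD('a) = q"
    and "f = monom 1 (q - p)"
  shows "pg_deg (S_set f) = p"
proof -
  have q: "CARD('a) = p ^ 2" and f: "f = monom 1 (p ^ 2 - p)"
    using assms by simp_all
  have le: "card {P \<in> S_set f. P \<subseteq> L} \<le> p" if "L \<in> pg_lines" for L
    using card_S_set_inter_line_le[OF assms(1) q that] f by simp
  obtain L :: "('a ^ 3) set" where L: "L \<in> pg_lines" "p \<le> card {P \<in> S_set f. P \<subseteq> L}"
    using ex_line_card_S_set_inter_ge[OF assms(1) q] f by metis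
  then have "card {P \<in> S_set f. P \<subseteq> L} = p"
    using le by (simp add: le_antisym)
  with L have "u_lines p (S_set f) \<noteq> 0"
    by (auto simp: u_lines_def)
  moreover have bound: "i \<le> p" if "u_lines i (S_set f) \<noteq> 0" for i
  proof -
    \<comment> \<open>A nonzero count provides a line with exactly \<open>i\<close> points, to which
      the upper bound applies.\<close>
    have "{L \<in> pg_lines. card {P \<in> S_set f. P \<subseteq> L} = i} \<noteq> {}"
      using that unfolding u_lines_def by (metis card.empty)
    then show ?thesis
      using le by blast
  qed
  \<comment> \<open>Finiteness is required for \<open>Max\<close> to be the actual maximum.\<close>
  moreover have "finite {i. u_lines i (S_set f) \<noteq> 0}"
    using bound by (auto intro: finite_subset[OF _ finite_atMost[of p]])
  ultimately show ?thesis
    unfolding pg_deg_def by (intro Max_eqI) auto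
qed

end
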